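(* Let $\mathcal{X}$ be an infinite-dimensional real Banach space and let $\mathcal{A}\subset\mathcal{B}(\mathcal{X})$ be an $L$-algebra of quaternion type. Then there is a closed regular representation $\pi$ of the quaternion group $G_{\mathbb{H}}$ on a dense linear subspace $\mathcal{E}$ of $\mathcal{X}$, with $\pi(1)=-\pi(-1)=\mathbf{1}_{\mathcal{E}}$, such that $\mathcal{A}$ is contained in $$\mathcal{A}_\pi=\{T\in\mathcal{B}(\mathcal{X}): T\mathcal{E}\subseteq\mathcal{E}\text{ and }T\pi(g)|_{\mathcal{E}}=\pi(g)T|_{\mathcal{E}}\text{ for all }g\in G_{\mathbb{H}}\},$$ and $\mathcal{A}_\pi$ is a Lomonosov algebra of quaternion type.
   Context: $G_{\mathbb{H}}=\{\pm1,\pm i,\pm j,\pm k\}\subset\mathbb{H}$ is the quaternion group: $(-1)^2=1$, $i^2=j^2=k^2=-1$, $ijk=-1$. Let $\pi$ be a representation of a finite group $G$ with unit $e_G$ by linear operators (not assumed bounded) on a dense linear subspace $\mathcal{E}$ of $\mathcal{X}$. $\pi$ is closed if, whenever $(x_n)$ is a sequence in $\mathcal{E}$ such that $\pi(g)x_n\to w(g)\in\mathcal{X}$ for all $g\in G$, there is $x\in\mathcal{E}$ with $w(g)=\pi(g)x$ for all $g\in G$. Put $\mathcal{E}^*=\{f\in\mathcal{X}^*: \text{there is } C>0 \text{ with } |f(\pi(g)x)|\le C\|x\| \text{ for all } x\in\mathcal{E}, g\in G\}$; $\pi$ is regular if $\mathcal{E}^*$ is weak*-dense in $\mathcal{X}^*$.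 $\mathcal{B}(\mathcal{X})$ is the algebra of all bounded linear operators on $\mathcal{X}$; SOT is the strong operator topology. A subalgebra of $\mathcal{B}(\mathcal{X})$ (not assumed unital or closed) is transitive if it has no non-trivial closed invariant subspaces. A Lomonosov algebra is an SOT-closed transitive subalgebra of $\mathcal{B}(\mathcal{X})$ containing a non-zero compact operator; an $L$-algebra is a transitive subalgebra containing a non-zero finite rank operator. (Lomonosov algebras are exactly the SOT-closed $L$-algebras.) For an $L$-algebra $\mathcal{A}$, $\mathcal{A}^F$ is the set of all finite rank operators in $\mathcal{A}$, $\mathcal{X}^F=\mathrm{lin}\{Tx: T\in\mathcal{A}^F, x\in\mathcal{X}\}$, and $\mathbb{D}$ is the algebra of all linear operators $\mathcal{X}^F\to\mathcal{X}^F$ (not assumed bounded) commuting with the restrictions to $\mathcal{X}^F$ of all operators in $\mathcal{A}^F$; $\mathbb{D}$ is always isomorphic to $\mathbb{R}$, $\mathbb{C}$ or the quaternions $\mathbb{H}$, and $\mathcal{A}$ is said to be of real, complex or quaternion type, respectively. *)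

theory Defs
  imports "HOL-Analysis.Analysis" "HOL-Algebra.Group"
begin

section \<open>Quaternions and the quaternion group\<close>

text \<open>\<open>Quat a b c d\<close> stands for $a + bi + cj + dk$.\<close>

datatype quat = Quat (qre: real) (qi: real) (qj: real) (qk: real)

instantiation quat :: real_algebra_1
begin

definition "0 = Quat 0 0 0 0"

definition "1 = Quat 1 0 0 0"

definition "p + q = Quat (qre p + qre q) (qi p + qi q) (qj p + qj q) (qk p + qk q)"

definition "p - q = Quat (qre p - qre q) (qi p - qi q) (qj p - qj q) (qk p - qk q)"

definition "- q = Quat (- qre q) (- qi q) (- qj q) (- qk q)"

definition "r *\<^sub>R q = Quat (r * qre q) (r * qi q) (r * qj q) (r * qk q)"

definition "p * q = Quat
  (qre p * qre q - qi p * qi q - qj p * qj q - qk p * qk q)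
  (qre p * qi q + qi p * qre q + qj p * qk q - qk p * qj q)
  (qre p * qj q - qi p * qk q + qj p * qre q + qk p * qi q)
  (qre p * qk q + qi p * qj q - qj p * qi q + qk p * qre q)"

instance
  by standard
    (simp_all add: zero_quat_def one_quat_def plus_quat_def minus_quat_def uminus_quat_def
      scaleR_quat_def times_quat_def algebra_simps)

end

definition quat_i :: quat where "quat_i = Quat 0 1 0 0"

definition quat_j :: quat where "quat_j = Quat 0 0 1 0"

definition quat_k :: quat where "quat_k = Quat 0 0 0 1"

definition quaternion_group :: "quat monoid" where
  "quaternion_group =
     \<lparr>carrier = {1, -1, quat_i, - quat_i, quat_j, - quat_j, quat_k, - quat_k},
      monoid.mult = (*), one = 1\<rparr>"

lemma quat_relations:
  "(-1 :: quat) * (-1) = 1" "quat_i * quat_i = -1" "quat_j * quat_j = -1"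
  "quat_k * quat_k = -1" "quat_i * quat_j * quat_k = -1"
  by (simp_all add: quat_i_def quat_j_def quat_k_def one_quat_def uminus_quat_def times_quat_def)

lemma group_quaternion_group: "group quaternion_group"
proof -
  have C: "carrier quaternion_group =
      {Quat 1 0 0 0, Quat (-1) 0 0 0, Quat 0 1 0 0, Quat 0 (-1) 0 0,
       Quat 0 0 1 0, Quat 0 0 (-1) 0, Quat 0 0 0 1, Quat 0 0 0 (-1)}"
    by (simp add: quaternion_group_def quat_i_def quat_j_def quat_k_def one_quat_def
        uminus_quat_def)
  have M: "x \<otimes>\<^bsub>quaternion_group\<^esub> y = x * y" "\<one>\<^bsub>quaternion_group\<^esub> = 1" for x y
    by (simp_all add: quaternion_group_def)
  show ?thesis
  proof (rule groupI)
    fix x y assume "x \<in> carrier quaternion_group" "y \<in> carrier quaternion_group"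
    then show "x \<otimes>\<^bsub>quaternion_group\<^esub> y \<in> carrier quaternion_group"
      unfolding C M by (elim insertE emptyE) (simp_all add: times_quat_def)
  next
    fix x assume "x \<in> carrier quaternion_group"
    then show "\<exists>y\<in>carrier quaternion_group. y \<otimes>\<^bsub>quaternion_group\<^esub> x = \<one>\<^bsub>quaternion_group\<^esub>"
      unfolding C M by (elim insertE emptyE) (simp_all add: times_quat_def one_quat_def)
  qed (simp_all add: M C one_quat_def[symmetric] mult.assoc)
qed

lemma finite_quaternion_group: "finite (carrier quaternion_group)"
  by (simp add: quaternion_group_def)


section \<open>Representations by unbounded operators\<close>

text \<open>Operators on a subspace \<open>V\<close> are functions on the whole type; only their values on \<open>V\<close> matter.\<close>

definition linear_operator_on :: "'a::real_vector set \<Rightarrow> ('a \<Rightarrow> 'a) \<Rightarrow> bool" where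
  "linear_operator_on V S \<longleftrightarrow>
     S ` V \<subseteq> V \<and>
     (\<forall>x\<in>V. \<forall>y\<in>V. S (x + y) = S x + S y) \<and>
     (\<forall>r. \<forall>x\<in>V. S (r *\<^sub>R x) = r *\<^sub>R S x)"

definition group_representation ::
    "('g, 'm) monoid_scheme \<Rightarrow> 'a::real_normed_vector set \<Rightarrow> ('g \<Rightarrow> 'a \<Rightarrow> 'a) \<Rightarrow> bool" where
  "group_representation G E \<pi> \<longleftrightarrow>
     group G \<and> finite (carrier G) \<and>
     subspace E \<and> closure E = UNIV \<and>
     (\<forall>g\<in>carrier G. linear_operator_on E (\<pi> g)) \<and>
     (\<forall>x\<in>E. \<pi> \<one>\<^bsub>G\<^esub> x = x) \<and>
     (\<forall>g\<in>carrier G. \<forall>h\<in>carrier G. \<forall>x\<in>E. \<pi> (g \<otimes>\<^bsub>G\<^esub> h) x = \<pi> g (\<pi> h x))"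

definition closed_representation ::
    "('g, 'm) monoid_scheme \<Rightarrow> 'a::real_normed_vector set \<Rightarrow> ('g \<Rightarrow> 'a \<Rightarrow> 'a) \<Rightarrow> bool" where
  "closed_representation G E \<pi> \<longleftrightarrow>
     (\<forall>(x :: nat \<Rightarrow> 'a) (w :: 'g \<Rightarrow> 'a).
        (\<forall>n. x n \<in> E) \<and> (\<forall>g\<in>carrier G. (\<lambda>n. \<pi> g (x n)) \<longlonglongrightarrow> w g) \<longrightarrow>
        (\<exists>y\<in>E. \<forall>g\<in>carrier G. w g = \<pi> g y))"

definition representation_dual ::
    "('g, 'm) monoid_scheme \<Rightarrow> 'a::real_normed_vector set \<Rightarrow> ('g \<Rightarrow> 'a \<Rightarrow> 'a) \<Rightarrow> ('a \<Rightarrow>\<^sub>L real) set"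
  where
  "representation_dual G E \<pi> =
     {f. \<exists>C>0. \<forall>x\<in>E. \<forall>g\<in>carrier G. \<bar>blinfun_apply f (\<pi> g x)\<bar> \<le> C * norm x}"

text \<open>On the dual space the topology of pointwise convergence, i.e. the library's
  \<open>strong_operator_topology\<close> for scalar-valued functionals, is the weak* topology.\<close>

abbreviation weak_star_topology :: "('a::real_normed_vector \<Rightarrow>\<^sub>L real) topology" where
  "weak_star_topology \<equiv> strong_operator_topology"

definition regular_representation ::
    "('g, 'm) monoid_scheme \<Rightarrow> 'a::real_normed_vector set \<Rightarrow> ('g \<Rightarrow> 'a \<Rightarrow> 'a) \<Rightarrow> bool" where
  "regular_representation G E \<pi> \<longleftrightarrow>
     weak_star_topology closure_of (representation_dual G E \<pi>) = UNIV"

definition representation_commutant ::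
    "('g, 'm) monoid_scheme \<Rightarrow> 'a::real_normed_vector set \<Rightarrow> ('g \<Rightarrow> 'a \<Rightarrow> 'a) \<Rightarrow> ('a \<Rightarrow>\<^sub>L 'a) set"
  where
  "representation_commutant G E \<pi> =
     {T. blinfun_apply T ` E \<subseteq> E \<and>
         (\<forall>g\<in>carrier G. \<forall>x\<in>E. blinfun_apply T (\<pi> g x) = \<pi> g (blinfun_apply T x))}"


section \<open>Transitive operator algebras\<close>

definition operator_subalgebra :: "('a::real_normed_vector \<Rightarrow>\<^sub>L 'a) set \<Rightarrow> bool" where
  "operator_subalgebra A \<longleftrightarrow> subspace A \<and> (\<forall>S\<in>A. \<forall>T\<in>A. S o\<^sub>L T \<in> A)"

definition transitive_algebra :: "('a::real_normed_vector \<Rightarrow>\<^sub>L 'a) set \<Rightarrow> bool" where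
  "transitive_algebra A \<longleftrightarrow>
     operator_subalgebra A \<and>
     (\<forall>V. subspace V \<and> closed V \<and> (\<forall>T\<in>A. blinfun_apply T ` V \<subseteq> V) \<longrightarrow> V = {0} \<or> V = UNIV)"

definition finite_rank :: "('a::real_normed_vector \<Rightarrow>\<^sub>L 'a) \<Rightarrow> bool" where
  "finite_rank T \<longleftrightarrow> (\<exists>B. finite B \<and> range (blinfun_apply T) \<subseteq> span B)"

definition compact_operator :: "('a::real_normed_vector \<Rightarrow>\<^sub>L 'a) \<Rightarrow> bool" where
  "compact_operator T \<longleftrightarrow> compact (closure (blinfun_apply T ` cball 0 1))"

definition Lomonosov_algebra :: "('a::real_normed_vector \<Rightarrow>\<^sub>L 'a) set \<Rightarrow> bool" where
  "Lomonosov_algebra A \<longleftrightarrow>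
     transitive_algebra A \<and> closedin strong_operator_topology A \<and>
     (\<exists>T\<in>A. T \<noteq> 0 \<and> compact_operator T)"

definition L_algebra :: "('a::real_normed_vector \<Rightarrow>\<^sub>L 'a) set \<Rightarrow> bool" where
  "L_algebra A \<longleftrightarrow> transitive_algebra A \<and> (\<exists>T\<in>A. T \<noteq> 0 \<and> finite_rank T)"


section \<open>The type of an L-algebra\<close>

definition finite_rank_part :: "('a::real_normed_vector \<Rightarrow>\<^sub>L 'a) set \<Rightarrow> ('a \<Rightarrow>\<^sub>L 'a) set" where
  "finite_rank_part A = {T\<in>A. finite_rank T}"

definition finite_rank_space :: "('a::real_normed_vector \<Rightarrow>\<^sub>L 'a) set \<Rightarrow> 'a set" where
  "finite_rank_space A = span {blinfun_apply T x | T x. T \<in> finite_rank_part A}"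

text \<open>Restricting to \<open>extensional\<close> functions makes elements of the commutant correspond bijectively
  to the operators on the subspace.\<close>

definition finite_rank_commutant :: "('a::real_normed_vector \<Rightarrow>\<^sub>L 'a) set \<Rightarrow> ('a \<Rightarrow> 'a) set" where
  "finite_rank_commutant A =
     {S \<in> extensional (finite_rank_space A).
        linear_operator_on (finite_rank_space A) S \<and>
        (\<forall>T\<in>finite_rank_part A. \<forall>x\<in>finite_rank_space A.
           S (blinfun_apply T x) = blinfun_apply T (S x))}"

text \<open>\<open>\<Phi>\<close> is an isomorphism of real algebras from the type \<open>'b\<close> onto the algebra \<open>D\<close> of
  operators on \<open>V\<close>, with pointwise linear operations and composition as multiplication.\<close>

definition operator_algebra_iso ::
    "'a::real_vector set \<Rightarrow> ('a \<Rightarrow> 'a) set \<Rightarrow> ('b::real_algebra_1 \<Rightarrow> 'a \<Rightarrow> 'a) \<Rightarrow> bool" where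
  "operator_algebra_iso V D \<Phi> \<longleftrightarrow>
     bij_betw \<Phi> UNIV D \<and>
     (\<forall>p q. \<forall>x\<in>V. \<Phi> (p + q) x = \<Phi> p x + \<Phi> q x) \<and>
     (\<forall>r p. \<forall>x\<in>V. \<Phi> (r *\<^sub>R p) x = r *\<^sub>R \<Phi> p x) \<and>
     (\<forall>p q. \<forall>x\<in>V. \<Phi> (p * q) x = \<Phi> p (\<Phi> q x))"

definition quaternion_type :: "('a::real_normed_vector \<Rightarrow>\<^sub>L 'a) set \<Rightarrow> bool" where
  "quaternion_type A \<longleftrightarrow>
     L_algebra A \<and>
     (\<exists>\<Phi> :: quat \<Rightarrow> 'a \<Rightarrow> 'a.
        operator_algebra_iso (finite_rank_space A) (finite_rank_commutant A) \<Phi>)"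

end

theory Submission
  imports Defs
begin

text \<open>
  Let \<open>F\<close> be the set of finite rank operators in \<open>A\<close>, let \<open>X\<^sub>F\<close> be the span of their ranges, and let
  \<open>\<Phi>\<close> be the action of the quaternions on \<open>X\<^sub>F\<close>.  By transitivity \<open>X\<^sub>F\<close> is dense and the operators in
  \<open>F\<close> have trivial common kernel.  The operator \<open>\<Phi> q\<close> may be unbounded, but \<open>\<Phi> q \<circ> S\<close> is bounded for
  every \<open>S\<close> in \<open>F\<close>, because \<open>S\<close> has finite-dimensional range (\<open>bounded_linear_Phi_compose\<close>).  The
  representation is the largest extension of \<open>\<Phi>\<close> that commutes with \<open>F\<close>: a vector \<open>x\<close> belongs to its
  domain if for every \<open>q\<close> there is some \<open>w\<close>, necessarily unique and denoted \<open>action q x\<close>, such that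
  \<open>S w = \<Phi> q (S x)\<close> for all \<open>S\<close> in \<open>F\<close>.

  Both sides of these equations depend continuously on \<open>w\<close> and \<open>x\<close>.  This makes the representation
  closed, and it makes its commutant \<open>B\<close> closed in the strong operator topology, as \<open>T\<close> belongs to
  \<open>B\<close> if and only if \<open>S (T (action q x)) = \<Phi> q (S (T x))\<close> for all \<open>S\<close>, \<open>q\<close>, \<open>x\<close> (\<open>commutant_eq\<close>).
  As \<open>F\<close> is an ideal of \<open>A\<close>, the equations are preserved by \<open>A\<close>, so \<open>A \<subseteq> B\<close>, and \<open>B\<close> inherits
  transitivity and a non-zero finite rank operator.  For regularity, the functionals \<open>f \<circ> S\<close>
  with \<open>S\<close> in \<open>F\<close> are dominated as required; their common kernel is closed and invariant, so
  they separate points unless the dual space is zero, and a separating space of functionals is weak* dense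
  (\<open>total_functionals_weak_star_dense\<close>).

  The type of \<open>B\<close> is found by comparison with that of \<open>A\<close>.  The finite rank operators of \<open>B\<close> have
  their ranges inside the domain, so each \<open>action q\<close> restricts to an element of the finite rank commutant
  of \<open>B\<close>.  Conversely, such an element restricts on \<open>X\<^sub>F\<close> to some \<open>\<Phi> q\<close>, and by uniqueness of \<open>w\<close> it
  agrees with \<open>action q\<close> (\<open>finite_rank_commutant_eq_action\<close>).
\<close>

section \<open>Finite-dimensional subspaces of normed spaces\<close>

text \<open>The distance \<open>d\<close> from \<open>a\<close> to \<open>V\<close> is positive, and \<open>k a + y\<close> has norm at least \<open>d \<bar>k\<bar>\<close>.  So
  adding one dimension to a closed subspace introduces a coordinate that depends boundedly on the
  vector, which drives the inductions on the spanning set below.\<close>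

lemma coefficient_bound:
  fixes a :: "'a::real_normed_vector"
  assumes V: "subspace V" "closed V" and a: "a \<notin> V"
  obtains d where "d > 0" "\<And>k y. y \<in> V \<Longrightarrow> d * \<bar>k\<bar> \<le> norm (k *\<^sub>R a + y)"
proof
  show "infdist a V > 0"
    using V a infdist_pos_not_in_closed subspace_0 by blast
  fix k :: real and y assume y: "y \<in> V"
  show "infdist a V * \<bar>k\<bar> \<le> norm (k *\<^sub>R a + y)"
  proof (cases "k = 0")
    case False
    have "(- 1 / k) *\<^sub>R y \<in> V"
      using V(1) y by (rule subspace_scale)
    then have "infdist a V \<le> norm (a - (- 1 / k) *\<^sub>R y)"
      unfolding dist_norm[symmetric] by (rule infdist_le)
    then have "infdist a V * \<bar>k\<bar> \<le> norm (a - (- 1 / k) *\<^sub>R y) * \<bar>k\<bar>"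
      by (rule mult_right_mono) simp
    also have "\<dots> = norm (k *\<^sub>R (a - (- 1 / k) *\<^sub>R y))"
      by simp
    also have "k *\<^sub>R (a - (- 1 / k) *\<^sub>R y) = k *\<^sub>R a + y"
      using False by (simp add: algebra_simps)
    finally show ?thesis .
  qed simp
qed

text \<open>The coordinates along \<open>a\<close> of a convergent sequence form a Cauchy sequence.\<close>

lemma closed_span_finite:
  fixes B :: "'a::real_normed_vector set"
  assumes "finite B"
  shows "closed (span B)"
  using assms
proof (induction B rule: finite_induct)
  case empty
  then show ?case by simp
next
  case (insert a B)
  show ?case
  proof (cases "a \<in> span B")
    case True
    then show ?thesis using insert by (simp add: span_redundant)
  next
    case False
    obtain d where d: "d > 0" "\<And>k y. y \<in> span B \<Longrightarrow> d * \<bar>k\<bar> \<le> norm (k *\<^sub>R a + y)"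
      using coefficient_bound[OF subspace_span insert.IH False] by blast
    show ?thesis
      unfolding closed_sequential_limits
    proof (intro allI impI, elim conjE)
      fix x l assume x: "\<forall>n. x n \<in> span (insert a B)" and l: "x \<longlonglongrightarrow> l"
      then obtain k where k: "\<And>n. x n - k n *\<^sub>R a \<in> span B"
        unfolding span_breakdown_eq by metis
      have "Cauchy k"
      proof (rule metric_CauchyI)
        fix e :: real assume "e > 0"
        moreover have "Cauchy x" using l by (rule LIMSEQ_imp_Cauchy)
        ultimately obtain M where M: "\<And>m n. m \<ge> M \<Longrightarrow> n \<ge> M \<Longrightarrow> dist (x m) (x n) < d * e"
          using d(1) metric_CauchyD[of x "d * e"] by auto
        have "dist (k m) (k n) < e" if "m \<ge> M" "n \<ge> M" for m n
        proof -
          have "(x m - k m *\<^sub>R a) - (x n - k n *\<^sub>R a) \<in> span B"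
            by (rule span_diff[OF k k])
          from d(2)[OF this, of "k m - k n"] have "d * \<bar>k m - k n\<bar> \<le> dist (x m) (x n)"
            by (simp add: dist_norm algebra_simps)
          then have "d * \<bar>k m - k n\<bar> < d * e" using M[OF that] by linarith
          then show ?thesis using d(1) by (simp add: dist_real_def)
        qed
        then show "\<exists>M. \<forall>m\<ge>M. \<forall>n\<ge>M. dist (k m) (k n) < e" by blast
      qed
      then obtain c where c: "k \<longlonglongrightarrow> c"
        using real_Cauchy_convergent convergent_def by blast
      have "(\<lambda>n. x n - k n *\<^sub>R a) \<longlonglongrightarrow> l - c *\<^sub>R a"
        by (intro tendsto_intros l c)
      with insert.IH k have "l - c *\<^sub>R a \<in> span B"
        by (rule closed_sequentially)
      then show "l \<in> span (insert a B)"
        unfolding span_breakdown_eq by blast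
    qed
  qed
qed

text \<open>The coordinate bound places the ball of the larger span inside the sum of a compact segment
  and a ball of the smaller span.\<close>

lemma compact_span_Int_cball:
  fixes B :: "'a::real_normed_vector set"
  assumes "finite B"
  shows "compact (span B \<inter> cball 0 r)"
  using assms
proof (induction B arbitrary: r rule: finite_induct)
  case empty
  show ?case by (simp add: compact_Int_closed)
next
  case (insert a B)
  show ?case
  proof (cases "a \<in> span B")
    case True
    then show ?thesis using insert by (simp add: span_redundant)
  next
    case False
    obtain d where d: "d > 0" "\<And>k y. y \<in> span B \<Longrightarrow> d * \<bar>k\<bar> \<le> norm (k *\<^sub>R a + y)"
      using coefficient_bound[OF subspace_span closed_span_finite[OF insert.hyps(1)] False] by blast
    define K where "K = {s + t | s t. s \<in> (\<lambda>k. k *\<^sub>R a) ` cball 0 (r / d) \<and>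
      t \<in> span B \<inter> cball 0 (r + r / d * norm a)}"
    have "compact ((\<lambda>k. k *\<^sub>R a) ` cball 0 (r / d))"
      by (intro compact_continuous_image continuous_intros compact_cball)
    then have "compact K"
      unfolding K_def by (intro compact_sums insert.IH)
    moreover have "closed (span (insert a B) \<inter> cball 0 r)"
      using insert.hyps by (intro closed_Int closed_span_finite closed_cball) auto
    moreover have "span (insert a B) \<inter> cball 0 r \<subseteq> K"
    proof
      fix x assume "x \<in> span (insert a B) \<inter> cball 0 r"
      then obtain k where k: "x - k *\<^sub>R a \<in> span B" and x: "norm x \<le> r"
        by (auto simp: span_breakdown_eq)
      have "d * \<bar>k\<bar> \<le> r" using d(2)[OF k, of k] x by simp
      then have kr: "\<bar>k\<bar> \<le> r / d" using d(1) by (simp add: field_simps)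
      have "norm (x - k *\<^sub>R a) \<le> norm x + \<bar>k\<bar> * norm a"
        using norm_triangle_ineq4[of x "k *\<^sub>R a"] by simp
      also have "\<dots> \<le> r + r / d * norm a"
        using x kr by (intro add_mono mult_right_mono) auto
      finally have "x - k *\<^sub>R a \<in> span B \<inter> cball 0 (r + r / d * norm a)"
        using k by simp
      moreover have "k *\<^sub>R a \<in> (\<lambda>k. k *\<^sub>R a) ` cball 0 (r / d)"
        using kr by auto
      moreover have "x = k *\<^sub>R a + (x - k *\<^sub>R a)" by simp
      ultimately show "x \<in> K" unfolding K_def by blast
    qed
    ultimately show ?thesis
      using compact_Int_closed[of K "span (insert a B) \<inter> cball 0 r"] by (simp add: inf_absorb2)
  qed
qed

lemma linear_bounded_on_span_finite:
  fixes B :: "'a::real_normed_vector set" and g :: "'a \<Rightarrow> 'b::real_normed_vector"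
  assumes "finite B"
    and add: "\<And>x y. x \<in> span B \<Longrightarrow> y \<in> span B \<Longrightarrow> g (x + y) = g x + g y"
    and scale: "\<And>r x. x \<in> span B \<Longrightarrow> g (r *\<^sub>R x) = r *\<^sub>R g x"
  obtains C where "\<And>x. x \<in> span B \<Longrightarrow> norm (g x) \<le> C * norm x"
proof -
  have "\<exists>C. \<forall>x\<in>span B. norm (g x) \<le> C * norm x"
    using assms
  proof (induction B rule: finite_induct)
    case empty
    have "g 0 = 0" using empty(2)[of 0 0] by simp
    then show ?case by simp
  next
    case (insert a B)
    have sub: "span B \<subseteq> span (insert a B)"
      by (rule span_mono) blast
    obtain C where C: "\<And>x. x \<in> span B \<Longrightarrow> norm (g x) \<le> C * norm x"
      using insert.IH insert.prems sub by blast
    show ?case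
    proof (cases "a \<in> span B")
      case True
      then show ?thesis using C by (auto simp: span_redundant)
    next
      case False
      obtain d where d: "d > 0" "\<And>k y. y \<in> span B \<Longrightarrow> d * \<bar>k\<bar> \<le> norm (k *\<^sub>R a + y)"
        using coefficient_bound[OF subspace_span closed_span_finite[OF insert.hyps(1)] False] by blast
      have "norm (g x) \<le> (norm (g a) / d + \<bar>C\<bar> * (1 + norm a / d)) * norm x"
        if x: "x \<in> span (insert a B)" for x
      proof -
        obtain k where k: "x - k *\<^sub>R a \<in> span B"
          using x by (auto simp: span_breakdown_eq)
        have a: "a \<in> span (insert a B)" by (simp add: span_base)
        have "g x = g (k *\<^sub>R a + (x - k *\<^sub>R a))" by simp
        also have "\<dots> = g (k *\<^sub>R a) + g (x - k *\<^sub>R a)"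
          using insert.prems(1) a k sub span_scale by blast
        also have "g (k *\<^sub>R a) = k *\<^sub>R g a" using insert.prems(2) a by blast
        finally have g: "norm (g x) \<le> \<bar>k\<bar> * norm (g a) + norm (g (x - k *\<^sub>R a))"
          using norm_triangle_ineq[of "k *\<^sub>R g a" "g (x - k *\<^sub>R a)"] by simp
        have "d * \<bar>k\<bar> \<le> norm x" using d(2)[OF k, of k] by simp
        then have kx: "\<bar>k\<bar> \<le> norm x / d" using d(1) by (simp add: field_simps)
        have "norm (x - k *\<^sub>R a) \<le> norm x + \<bar>k\<bar> * norm a"
          using norm_triangle_ineq4[of x "k *\<^sub>R a"] by simp
        also have "\<dots> \<le> norm x + norm x / d * norm a"
          using kx by (intro add_left_mono mult_right_mono) auto
        finally have "\<bar>C\<bar> * norm (x - k *\<^sub>R a) \<le> \<bar>C\<bar> * (norm x + norm x / d * norm a)"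
          by (rule mult_left_mono) simp
        moreover have "C * norm (x - k *\<^sub>R a) \<le> \<bar>C\<bar> * norm (x - k *\<^sub>R a)"
          by (intro mult_right_mono) auto
        moreover have "\<bar>k\<bar> * norm (g a) \<le> norm x / d * norm (g a)"
          using kx by (intro mult_right_mono) auto
        ultimately have "norm (g x) \<le> norm x / d * norm (g a) + \<bar>C\<bar> * (norm x + norm x / d * norm a)"
          using g C[OF k] by linarith
        then show ?thesis by (simp add: algebra_simps)
      qed
      then show ?thesis by blast
    qed
  qed
  then show ?thesis using that by blast
qed

lemma subspace_of_span_finite:
  assumes "finite B" "subspace V" "V \<subseteq> span B"
  obtains C where "finite C" "V = span C"
proof -
  obtain C where C: "C \<subseteq> V" "independent C" "V \<subseteq> span C"
    by (rule maximal_independent_subset)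
  have "finite C"
    using independent_span_bound[OF assms(1) C(2)] C(1) assms(3) by blast
  moreover have "V = span C"
    using C(3) span_minimal[OF C(1) assms(2)] by blast
  ultimately show ?thesis by (rule that)
qed

lemma subspace_closure:
  fixes V :: "'a::real_normed_vector set"
  assumes "subspace V"
  shows "subspace (closure V)"
  unfolding subspace_def
proof (intro conjI ballI allI)
  show "0 \<in> closure V" using assms closure_subset subspace_0 by blast
next
  fix x y assume "x \<in> closure V" "y \<in> closure V"
  then obtain a b where "\<forall>n. a n \<in> V" "a \<longlonglongrightarrow> x" "\<forall>n. b n \<in> V" "b \<longlonglongrightarrow> y"
    unfolding closure_sequential by blast
  then have "\<forall>n. a n + b n \<in> V" "(\<lambda>n. a n + b n) \<longlonglongrightarrow> x + y"
    using assms by (auto intro: tendsto_add subspace_add)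
  then show "x + y \<in> closure V"
    unfolding closure_sequential by (intro exI[of _ "\<lambda>n. a n + b n"] conjI)
next
  fix c x assume "x \<in> closure V"
  then obtain a where "\<forall>n. a n \<in> V" "a \<longlonglongrightarrow> x"
    unfolding closure_sequential by blast
  then have "\<forall>n. c *\<^sub>R a n \<in> V" "(\<lambda>n. c *\<^sub>R a n) \<longlonglongrightarrow> c *\<^sub>R x"
    using assms by (auto intro: tendsto_scaleR subspace_scale)
  then show "c *\<^sub>R x \<in> closure V"
    unfolding closure_sequential by (intro exI[of _ "\<lambda>n. c *\<^sub>R a n"] conjI)
qed

section \<open>Operators of finite rank\<close>

lemma linear_blinfun_apply: "linear (blinfun_apply T)"
  by (simp add: blinfun.bounded_linear_right bounded_linear.linear)

lemma blinfun_nonzero_apply: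
  assumes "T \<noteq> 0"
  obtains x where "blinfun_apply T x \<noteq> 0"
  using assms blinfun_eqI[of T 0] by auto

lemma finite_rank_compose:
  assumes "finite_rank S"
  shows "finite_rank (S o\<^sub>L T)" "finite_rank (T o\<^sub>L S)"
proof -
  obtain B where B: "finite B" "range (blinfun_apply S) \<subseteq> span B"
    using assms unfolding finite_rank_def by blast
  then show "finite_rank (S o\<^sub>L T)"
    unfolding finite_rank_def by auto
  have "range (blinfun_apply (T o\<^sub>L S)) \<subseteq> blinfun_apply T ` span B"
    using B(2) by auto
  also have "\<dots> = span (blinfun_apply T ` B)"
    by (simp add: linear_span_image linear_blinfun_apply)
  finally show "finite_rank (T o\<^sub>L S)"
    using B(1) unfolding finite_rank_def by blast
qed

lemma compact_operator_finite_rank: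
  assumes "finite_rank T"
  shows "compact_operator T"
proof -
  obtain B where B: "finite B" "range (blinfun_apply T) \<subseteq> span B"
    using assms unfolding finite_rank_def by blast
  have sub: "blinfun_apply T ` cball 0 1 \<subseteq> span B \<inter> cball 0 (norm T)"
  proof
    fix y assume "y \<in> blinfun_apply T ` cball 0 1"
    then obtain x where "norm x \<le> 1" "y = blinfun_apply T x" by auto
    moreover have "norm T * norm x \<le> norm T * 1" using \<open>norm x \<le> 1\<close> by (rule mult_left_mono) simp
    ultimately show "y \<in> span B \<inter> cball 0 (norm T)"
      using norm_blinfun[of T x] B(2) by auto
  qed
  have K: "compact (span B \<inter> cball 0 (norm T))"
    by (rule compact_span_Int_cball) fact
  then have "closure (blinfun_apply T ` cball 0 1) \<subseteq> span B \<inter> cball 0 (norm T)"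
    by (intro closure_minimal sub compact_imp_closed)
  with compact_Int_closed[OF K closed_closure] show ?thesis
    unfolding compact_operator_def by (metis inf.absorb2)
qed

text \<open>The image of a dense subspace is dense in the range and, having finite dimension, closed.\<close>

lemma finite_rank_image_dense:
  assumes T: "finite_rank T" and V: "subspace V" "closure V = UNIV"
  shows "blinfun_apply T ` V = range (blinfun_apply T)"
proof -
  obtain B where B: "finite B" "range (blinfun_apply T) \<subseteq> span B"
    using T unfolding finite_rank_def by blast
  have "subspace (blinfun_apply T ` V)"
    using linear_blinfun_apply V(1) by (rule linear_subspace_image)
  moreover have "blinfun_apply T ` V \<subseteq> span B" using B(2) by blast
  ultimately obtain C where "finite C" "blinfun_apply T ` V = span C"
    by (rule subspace_of_span_finite[OF B(1)])
  then have "closed (blinfun_apply T ` V)" by (simp add: closed_span_finite)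
  then have "blinfun_apply T ` closure V \<subseteq> blinfun_apply T ` V"
    by (intro image_closure_subset linear_continuous_on blinfun.bounded_linear_right) auto
  then show ?thesis using V(2) by blast
qed

section \<open>Spaces of functionals\<close>

text \<open>A total space of functionals is rich enough to hit any values on finitely many linearly
  independent points: if \<open>e\<close> vanishes on \<open>P\<close> but not at \<open>p\<close>, then multiples of \<open>e\<close> correct other
  functionals at \<open>p\<close> without changing them on \<open>P\<close>.\<close>

lemma total_functionals_separate:
  fixes M :: "('a::real_normed_vector \<Rightarrow>\<^sub>L real) set"
  assumes M: "subspace M" and total: "\<And>x. (\<And>m. m \<in> M \<Longrightarrow> blinfun_apply m x = 0) \<Longrightarrow> x = 0"
    and "finite P" "x \<notin> span P"
  shows "\<exists>m\<in>M. (\<forall>p\<in>P. blinfun_apply m p = 0) \<and> blinfun_apply m x \<noteq> 0"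
  using \<open>finite P\<close> \<open>x \<notin> span P\<close>
proof (induction P arbitrary: x rule: finite_induct)
  case empty
  then show ?case using total by auto
next
  case (insert p P)
  show ?case
  proof (cases "p \<in> span P")
    case True
    then have "x \<notin> span P" using insert.prems by (simp add: span_redundant)
    then obtain m where m: "m \<in> M" "\<forall>p\<in>P. blinfun_apply m p = 0" "blinfun_apply m x \<noteq> 0"
      using insert.IH by blast
    have "blinfun_apply m p = 0"
      using True m(2) linear_eq_0_on_span[of "blinfun_apply m" P p]
      by (simp add: linear_blinfun_apply)
    with m show ?thesis by auto
  next
    case False
    then obtain e where e: "e \<in> M" "\<forall>p\<in>P. blinfun_apply e p = 0" "blinfun_apply e p \<noteq> 0"
      using insert.IH by blast
    \<comment> \<open>Subtracting a multiple of \<open>p\<close> puts \<open>x\<close> into the kernel of \<open>e\<close>; it stays outside \<open>span P\<close>.\<close>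
    define c where "c = blinfun_apply e x / blinfun_apply e p"
    have "x - c *\<^sub>R p \<notin> span P"
      using insert.prems by (auto simp: span_breakdown_eq)
    then obtain m where m: "m \<in> M" "\<forall>p\<in>P. blinfun_apply m p = 0" "blinfun_apply m (x - c *\<^sub>R p) \<noteq> 0"
      using insert.IH by blast
    define n where "n = m - (blinfun_apply m p / blinfun_apply e p) *\<^sub>R e"
    have "n \<in> M"
      unfolding n_def using M m(1) e(1) by (intro subspace_diff subspace_scale)
    moreover have "\<forall>q\<in>insert p P. blinfun_apply n q = 0"
      using m(2) e(2,3) by (auto simp: n_def blinfun.diff_left blinfun.scaleR_left)
    moreover have "blinfun_apply n x \<noteq> 0"
      using m(3) by (simp add: n_def c_def blinfun.diff_left blinfun.scaleR_left
          blinfun.diff_right blinfun.scaleR_right mult.commute)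
    ultimately show ?thesis by blast
  qed
qed

lemma total_functionals_interpolate:
  fixes M :: "('a::real_normed_vector \<Rightarrow>\<^sub>L real) set"
  assumes M: "subspace M" and total: "\<And>x. (\<And>m. m \<in> M \<Longrightarrow> blinfun_apply m x = 0) \<Longrightarrow> x = 0"
    and "finite P"
  shows "\<exists>m\<in>M. \<forall>p\<in>P. blinfun_apply m p = blinfun_apply f p"
  using \<open>finite P\<close>
proof (induction P rule: finite_induct)
  case empty
  then show ?case using subspace_0[OF M] by blast
next
  case (insert p P)
  then obtain m where m: "m \<in> M" "\<forall>p\<in>P. blinfun_apply m p = blinfun_apply f p" by blast
  show ?case
  proof (cases "p \<in> span P")
    case True
    have "blinfun_apply (m - f) p = 0"
      using True m(2) linear_eq_0_on_span[of "blinfun_apply (m - f)" P p]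
      by (simp add: linear_blinfun_apply blinfun.diff_left)
    with m show ?thesis by (auto simp: blinfun.diff_left)
  next
    case False
    then obtain e where e: "e \<in> M" "\<forall>p\<in>P. blinfun_apply e p = 0" "blinfun_apply e p \<noteq> 0"
      using total_functionals_separate[OF M total \<open>finite P\<close>] by blast
    define n where "n = m + ((blinfun_apply f p - blinfun_apply m p) / blinfun_apply e p) *\<^sub>R e"
    have "n \<in> M"
      unfolding n_def using M m(1) e(1) by (intro subspace_add subspace_scale)
    moreover have "\<forall>q\<in>insert p P. blinfun_apply n q = blinfun_apply f q"
      using m(2) e(2,3) by (auto simp: n_def blinfun.add_left blinfun.scaleR_left)
    ultimately show ?thesis by blast
  qed
qed

text \<open>A basic weak* neighbourhood constrains a functional at finitely many points only, so exact
  interpolation at these points yields density.\<close>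

lemma total_functionals_weak_star_dense:
  fixes M :: "('a::real_normed_vector \<Rightarrow>\<^sub>L real) set"
  assumes M: "subspace M" and total: "\<And>x. (\<And>m. m \<in> M \<Longrightarrow> blinfun_apply m x = 0) \<Longrightarrow> x = 0"
  shows "weak_star_topology closure_of M = UNIV"
proof -
  have "f \<in> weak_star_topology closure_of M" for f :: "'a \<Rightarrow>\<^sub>L real"
    unfolding in_closure_of
  proof (intro conjI allI impI; (elim conjE)?)
    show "f \<in> topspace weak_star_topology" by (simp add: strong_operator_topology_topspace)
  next
    fix U assume "f \<in> U" "openin weak_star_topology U"
    then obtain V where V: "open V" "U = blinfun_apply -` V"
      unfolding strong_operator_topology_def openin_pullback_topology by auto
    with \<open>f \<in> U\<close> have "openin (product_topology (\<lambda>i. euclidean) UNIV) V" "blinfun_apply f \<in> V"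
      by (auto simp: open_fun_def)
    from product_topology_open_contains_basis[OF this]
    obtain W where W: "blinfun_apply f \<in> Pi\<^sub>E UNIV W" "finite {i. W i \<noteq> UNIV}" "Pi\<^sub>E UNIV W \<subseteq> V"
      by auto
    obtain m where m: "m \<in> M" "\<forall>p\<in>{i. W i \<noteq> UNIV}. blinfun_apply m p = blinfun_apply f p"
      using total_functionals_interpolate[OF M total W(2), of f] by blast
    have "blinfun_apply m i \<in> W i" for i
      using m(2) W(1) by (cases "W i = UNIV") (auto simp: PiE_iff)
    then have "m \<in> U" using V(2) W(3) by (auto simp: PiE_iff)
    with m(1) show "\<exists>y. y \<in> M \<and> y \<in> U" by blast
  qed
  then show ?thesis by blast
qed

lemma subspace_representation_dual: "subspace (representation_dual G E \<pi>)"
  unfolding subspace_def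
proof (intro conjI ballI allI)
  show "0 \<in> representation_dual G E \<pi>"
    by (auto simp: representation_dual_def intro!: exI[of _ 1])
next
  fix f g assume "f \<in> representation_dual G E \<pi>" "g \<in> representation_dual G E \<pi>"
  then obtain C D where "C > 0" "D > 0"
    and C: "\<forall>x\<in>E. \<forall>h\<in>carrier G. \<bar>blinfun_apply f (\<pi> h x)\<bar> \<le> C * norm x"
    and D: "\<forall>x\<in>E. \<forall>h\<in>carrier G. \<bar>blinfun_apply g (\<pi> h x)\<bar> \<le> D * norm x"
    unfolding representation_dual_def by blast
  have "\<forall>x\<in>E. \<forall>h\<in>carrier G. \<bar>blinfun_apply (f + g) (\<pi> h x)\<bar> \<le> (C + D) * norm x"
  proof (intro ballI)
    fix x h assume "x \<in> E" "h \<in> carrier G"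
    then have "\<bar>blinfun_apply f (\<pi> h x)\<bar> \<le> C * norm x" "\<bar>blinfun_apply g (\<pi> h x)\<bar> \<le> D * norm x"
      using C D by auto
    then show "\<bar>blinfun_apply (f + g) (\<pi> h x)\<bar> \<le> (C + D) * norm x"
      by (simp add: blinfun.add_left distrib_right)
  qed
  with \<open>C > 0\<close> \<open>D > 0\<close> show "f + g \<in> representation_dual G E \<pi>"
    unfolding representation_dual_def by (auto intro!: exI[of _ "C + D"])
next
  fix r f assume "f \<in> representation_dual G E \<pi>"
  then obtain C where "C > 0"
    and C: "\<forall>x\<in>E. \<forall>h\<in>carrier G. \<bar>blinfun_apply f (\<pi> h x)\<bar> \<le> C * norm x"
    unfolding representation_dual_def by blast
  have "\<forall>x\<in>E. \<forall>h\<in>carrier G. \<bar>blinfun_apply (r *\<^sub>R f) (\<pi> h x)\<bar> \<le> ((\<bar>r\<bar> + 1) * C) * norm x"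
  proof (intro ballI)
    fix x h assume "x \<in> E" "h \<in> carrier G"
    then have "\<bar>r\<bar> * \<bar>blinfun_apply f (\<pi> h x)\<bar> \<le> (\<bar>r\<bar> + 1) * (C * norm x)"
      using C by (intro mult_mono) auto
    then show "\<bar>blinfun_apply (r *\<^sub>R f) (\<pi> h x)\<bar> \<le> ((\<bar>r\<bar> + 1) * C) * norm x"
      by (simp add: blinfun.scaleR_left abs_mult mult.assoc)
  qed
  with \<open>C > 0\<close> show "r *\<^sub>R f \<in> representation_dual G E \<pi>"
    unfolding representation_dual_def by (auto intro!: exI[of _ "(\<bar>r\<bar> + 1) * C"])
qed

section \<open>The finite rank part of an L-algebra\<close>

lemma finite_rank_part_ideal:
  assumes "L_algebra A" "S \<in> finite_rank_part A" "T \<in> A"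
  shows "S o\<^sub>L T \<in> finite_rank_part A" "T o\<^sub>L S \<in> finite_rank_part A"
  using assms finite_rank_compose
  by (auto simp: L_algebra_def transitive_algebra_def operator_subalgebra_def finite_rank_part_def)

lemma subspace_finite_rank_space: "subspace (finite_rank_space A)"
  unfolding finite_rank_space_def by (rule subspace_span)

lemma finite_rank_part_apply: "T \<in> finite_rank_part A \<Longrightarrow> blinfun_apply T x \<in> finite_rank_space A"
  unfolding finite_rank_space_def by (rule span_base) blast

lemma transitive_algebraD:
  assumes "transitive_algebra A" "subspace V" "closed V"
    "\<And>T x. T \<in> A \<Longrightarrow> x \<in> V \<Longrightarrow> blinfun_apply T x \<in> V"
  shows "V = {0} \<or> V = UNIV"
  using assms unfolding transitive_algebra_def by (simp add: image_subset_iff)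

text \<open>The closure of \<open>finite_rank_space A\<close> is a non-zero closed invariant subspace.\<close>

lemma finite_rank_space_dense:
  assumes "L_algebra A"
  shows "closure (finite_rank_space A) = UNIV"
proof -
  obtain T x where T: "T \<in> finite_rank_part A" "blinfun_apply T x \<noteq> 0"
    using assms by (auto simp: L_algebra_def finite_rank_part_def elim: blinfun_nonzero_apply)
  have inv: "blinfun_apply S ` finite_rank_space A \<subseteq> finite_rank_space A" if "S \<in> A" for S
  proof -
    have "blinfun_apply S ` {blinfun_apply T x |T x. T \<in> finite_rank_part A} \<subseteq> finite_rank_space A"
    proof clarify
      fix T x assume "T \<in> finite_rank_part A"
      then show "blinfun_apply S (blinfun_apply T x) \<in> finite_rank_space A"
        using finite_rank_part_apply[OF finite_rank_part_ideal(2)[OF assms _ that], of T x] by simp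
    qed
    then show ?thesis
      unfolding finite_rank_space_def
      by (simp add: linear_span_image[symmetric] linear_blinfun_apply span_minimal)
  qed
  have "blinfun_apply S ` closure (finite_rank_space A) \<subseteq> closure (finite_rank_space A)" if "S \<in> A" for S
    using inv[OF that] closure_subset
    by (intro image_closure_subset linear_continuous_on blinfun.bounded_linear_right) auto
  then have "closure (finite_rank_space A) = {0} \<or> closure (finite_rank_space A) = UNIV"
    using assms unfolding L_algebra_def
    by (intro transitive_algebraD subspace_closure subspace_finite_rank_space) auto
  then show ?thesis
    using T finite_rank_part_apply closure_subset by blast
qed

text \<open>The common kernel \<open>N\<close> of the finite rank operators in \<open>A\<close> is closed, and it is invariant
  because \<open>S T\<close> has finite rank when \<open>S\<close> does.  Since \<open>A\<close> has a non-zero finite rank operator,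
  \<open>N\<close> is not the whole space.\<close>

lemma finite_rank_common_kernel:
  assumes A: "L_algebra A" and w: "\<And>S. S \<in> finite_rank_part A \<Longrightarrow> blinfun_apply S w = 0"
  shows "w = 0"
proof -
  define N where "N = {w. \<forall>S\<in>finite_rank_part A. blinfun_apply S w = 0}"
  have "N = (\<Inter>S\<in>finite_rank_part A. blinfun_apply S -` {0})"
    by (auto simp: N_def)
  then have "closed N"
    by (auto intro!: closed_INT closed_vimage continuous_intros)
  moreover have "subspace N"
    by (auto simp: N_def subspace_def blinfun.add_right blinfun.scaleR_right)
  moreover have "blinfun_apply T x \<in> N" if "T \<in> A" "x \<in> N" for T x
    using that finite_rank_part_ideal(1)[OF A _ that(1)] by (fastforce simp: N_def)
  ultimately have "N = {0} \<or> N = UNIV"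
    using A unfolding L_algebra_def by (intro transitive_algebraD) auto
  moreover obtain T x where "T \<in> finite_rank_part A" "blinfun_apply T x \<noteq> 0"
    using A by (auto simp: L_algebra_def finite_rank_part_def elim: blinfun_nonzero_apply)
  then have "N \<noteq> UNIV" by (auto simp: N_def)
  ultimately show ?thesis using w by (auto simp: N_def)
qed

lemma transitive_algebra_superset:
  assumes "transitive_algebra A" "A \<subseteq> B" "operator_subalgebra B"
  shows "transitive_algebra B"
  using assms unfolding transitive_algebra_def by blast

section \<open>Extending the quaternionic structure to a closed representation\<close>

lemma quat_basis_expansion:
  "q = qre q *\<^sub>R 1 + qi q *\<^sub>R quat_i + qj q *\<^sub>R quat_j + qk q *\<^sub>R quat_k"
  by (cases q) (simp add: one_quat_def quat_i_def quat_j_def quat_k_def scaleR_quat_def plus_quat_def)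

locale quaternionic_L_algebra =
  fixes A :: "('a::banach \<Rightarrow>\<^sub>L 'a) set" and \<Phi> :: "quat \<Rightarrow> 'a \<Rightarrow> 'a"
  assumes L_algebra: "L_algebra A"
    and iso: "operator_algebra_iso (finite_rank_space A) (finite_rank_commutant A) \<Phi>"
begin

abbreviation "F \<equiv> finite_rank_part A"
abbreviation "X\<^sub>F \<equiv> finite_rank_space A"

lemma Phi_commutant: "\<Phi> q \<in> finite_rank_commutant A"
  using iso by (auto simp: operator_algebra_iso_def bij_betw_def)

lemma Phi_linear: "linear_operator_on X\<^sub>F (\<Phi> q)"
  using Phi_commutant by (simp add: finite_rank_commutant_def)

lemma Phi_in: "x \<in> X\<^sub>F \<Longrightarrow> \<Phi> q x \<in> X\<^sub>F"
  using Phi_linear[of q] by (auto simp: linear_operator_on_def)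

lemma Phi_commute: "T \<in> F \<Longrightarrow> x \<in> X\<^sub>F \<Longrightarrow> blinfun_apply T (\<Phi> q x) = \<Phi> q (blinfun_apply T x)"
  using Phi_commutant by (simp add: finite_rank_commutant_def)

lemma Phi_add: "x \<in> X\<^sub>F \<Longrightarrow> y \<in> X\<^sub>F \<Longrightarrow> \<Phi> q (x + y) = \<Phi> q x + \<Phi> q y"
  and Phi_scaleR: "x \<in> X\<^sub>F \<Longrightarrow> \<Phi> q (r *\<^sub>R x) = r *\<^sub>R \<Phi> q x"
  using Phi_linear by (simp_all add: linear_operator_on_def)

lemma Phi_add_left: "x \<in> X\<^sub>F \<Longrightarrow> \<Phi> (p + q) x = \<Phi> p x + \<Phi> q x"
  and Phi_scaleR_left: "x \<in> X\<^sub>F \<Longrightarrow> \<Phi> (r *\<^sub>R p) x = r *\<^sub>R \<Phi> p x"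
  and Phi_mult: "x \<in> X\<^sub>F \<Longrightarrow> \<Phi> (p * q) x = \<Phi> p (\<Phi> q x)"
  using iso by (simp_all add: operator_algebra_iso_def)

text \<open>Unitality follows from surjectivity: there is \<open>p\<close> with \<open>\<Phi> p\<close> the identity, and then
  \<open>\<Phi> 1 = \<Phi> p \<circ> \<Phi> 1 = \<Phi> (p 1) = \<Phi> p\<close>.\<close>

lemma Phi_one:
  assumes "x \<in> X\<^sub>F"
  shows "\<Phi> 1 x = x"
proof -
  have "restrict id X\<^sub>F \<in> finite_rank_commutant A"
    using subspace_finite_rank_space[of A] finite_rank_part_apply
    by (auto simp: finite_rank_commutant_def linear_operator_on_def subspace_add subspace_scale)
  then obtain p where p: "\<Phi> p = restrict id X\<^sub>F"
    using iso by (metis operator_algebra_iso_def bij_betw_imp_surj_on imageE)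
  have "\<Phi> p x = \<Phi> (p * 1) x" by simp
  also have "\<dots> = \<Phi> p (\<Phi> 1 x)" using assms by (rule Phi_mult)
  finally show ?thesis using p assms Phi_in by simp
qed

text \<open>\<open>\<Phi> q\<close> may be unbounded, but \<open>\<Phi> q \<circ> S\<close> is not, since \<open>\<Phi> q\<close> acts here only on the
  finite-dimensional range of \<open>S\<close>.\<close>

lemma bounded_linear_Phi_compose:
  assumes S: "S \<in> F"
  shows "bounded_linear (\<lambda>x. \<Phi> q (blinfun_apply S x))"
proof -
  obtain B' where B': "finite B'" "range (blinfun_apply S) \<subseteq> span B'"
    using S unfolding finite_rank_part_def finite_rank_def by blast
  have "subspace (range (blinfun_apply S))"
    using linear_subspace_image[OF linear_blinfun_apply subspace_UNIV] .
  with B' obtain B where B: "finite B" "range (blinfun_apply S) = span B"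
    by (metis subspace_of_span_finite)
  have sub: "span B \<subseteq> X\<^sub>F"
    unfolding B(2)[symmetric] using finite_rank_part_apply[OF S] by auto
  have add: "\<Phi> q (x + y) = \<Phi> q x + \<Phi> q y" if "x \<in> span B" "y \<in> span B" for x y
    using sub that by (auto intro: Phi_add)
  have scale: "\<Phi> q (r *\<^sub>R x) = r *\<^sub>R \<Phi> q x" if "x \<in> span B" for r x
    using sub that by (auto intro: Phi_scaleR)
  obtain C where C: "\<And>y. y \<in> span B \<Longrightarrow> norm (\<Phi> q y) \<le> C * norm y"
    using linear_bounded_on_span_finite[OF B(1), of "\<Phi> q", OF add scale] by blast
  have "norm (\<Phi> q (blinfun_apply S x)) \<le> norm x * (\<bar>C\<bar> * norm S)" for x
  proof -
    have "norm (\<Phi> q (blinfun_apply S x)) \<le> C * norm (blinfun_apply S x)"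
      by (rule C) (simp add: B(2)[symmetric])
    also have "\<dots> \<le> \<bar>C\<bar> * (norm S * norm x)"
      by (intro mult_mono norm_blinfun) auto
    finally show ?thesis by (simp add: mult_ac)
  qed
  then show ?thesis
    using S by (intro bounded_linear_intro)
      (simp_all add: blinfun.add_right blinfun.scaleR_right Phi_add Phi_scaleR finite_rank_part_apply)
qed

text \<open>\<open>w\<close> is the value at \<open>x\<close> of the largest extension of \<open>\<Phi> q\<close> that commutes with the finite rank
  operators of \<open>A\<close>.  It is unique because these operators have trivial common kernel.  Describing
  the extension by equations instead of as a closure of \<open>\<Phi> q\<close> lets algebraic identities pass to it
  without approximation arguments.\<close>

definition intertwined :: "quat \<Rightarrow> 'a \<Rightarrow> 'a \<Rightarrow> bool" where
  "intertwined q x w \<longleftrightarrow> (\<forall>S\<in>F. blinfun_apply S w = \<Phi> q (blinfun_apply S x))"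

definition domain :: "'a set" where
  "domain = {x. \<forall>q. \<exists>w. intertwined q x w}"

definition action :: "quat \<Rightarrow> 'a \<Rightarrow> 'a" where
  "action q x = (THE w. intertwined q x w)"

lemma action_eqI:
  assumes "intertwined q x w"
  shows "action q x = w"
  unfolding action_def
proof (rule the_equality)
  fix v assume "intertwined q x v"
  with assms have "v - w = 0"
    using finite_rank_common_kernel[OF L_algebra, of "v - w"]
    by (simp add: intertwined_def blinfun.diff_right)
  then show "v = w" by simp
qed fact

lemma intertwined_action: "x \<in> domain \<Longrightarrow> intertwined q x (action q x)"
  using action_eqI unfolding domain_def by blast

lemma finite_rank_action:
  "x \<in> domain \<Longrightarrow> S \<in> F \<Longrightarrow> blinfun_apply S (action q x) = \<Phi> q (blinfun_apply S x)"
  using intertwined_action by (simp add: intertwined_def)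

lemma domainI: "(\<And>q. intertwined q x (w q)) \<Longrightarrow> x \<in> domain"
  by (auto simp: domain_def)

lemma intertwined_add_right:
    "intertwined q x v \<Longrightarrow> intertwined q y w \<Longrightarrow> intertwined q (x + y) (v + w)"
  and intertwined_scaleR_right: "intertwined q x v \<Longrightarrow> intertwined q (r *\<^sub>R x) (r *\<^sub>R v)"
  and intertwined_add_left:
    "intertwined p x v \<Longrightarrow> intertwined q x w \<Longrightarrow> intertwined (p + q) x (v + w)"
  and intertwined_scaleR_left: "intertwined p x v \<Longrightarrow> intertwined (r *\<^sub>R p) x (r *\<^sub>R v)"
  and intertwined_one: "intertwined 1 x x"
  by (simp_all add: intertwined_def blinfun.add_right blinfun.scaleR_right Phi_add Phi_scaleR
      Phi_add_left Phi_scaleR_left Phi_one finite_rank_part_apply)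

lemma intertwined_Phi: "x \<in> X\<^sub>F \<Longrightarrow> intertwined q x (\<Phi> q x)"
  by (simp add: intertwined_def Phi_commute)

lemma intertwined_action_mult: "x \<in> domain \<Longrightarrow> intertwined p (action q x) (action (p * q) x)"
  by (simp add: intertwined_def finite_rank_action Phi_mult finite_rank_part_apply)

lemma finite_rank_space_subset_domain: "X\<^sub>F \<subseteq> domain"
  by (auto intro: domainI intertwined_Phi)

lemma subspace_domain: "subspace domain"
  unfolding subspace_def
proof (intro conjI ballI allI)
  show "0 \<in> domain"
    using finite_rank_space_subset_domain subspace_0[OF subspace_finite_rank_space] by blast
next
  fix x y assume "x \<in> domain" "y \<in> domain"
  then show "x + y \<in> domain"
    by (intro domainI[OF intertwined_add_right[OF intertwined_action intertwined_action]])
next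
  fix r x assume "x \<in> domain"
  then show "r *\<^sub>R x \<in> domain"
    by (intro domainI[OF intertwined_scaleR_right[OF intertwined_action]])
qed

lemma action_domain: "x \<in> domain \<Longrightarrow> action q x \<in> domain"
  by (rule domainI[OF intertwined_action_mult])

lemma action_mult: "x \<in> domain \<Longrightarrow> action (p * q) x = action p (action q x)"
  using action_eqI[OF intertwined_action_mult] by simp

lemma action_one: "action 1 x = x"
  by (rule action_eqI[OF intertwined_one])

lemma action_add_left: "x \<in> domain \<Longrightarrow> action (p + q) x = action p x + action q x"
  and action_scaleR_left: "x \<in> domain \<Longrightarrow> action (r *\<^sub>R p) x = r *\<^sub>R action p x"
  by (simp_all add: action_eqI intertwined_add_left intertwined_scaleR_left intertwined_action)

lemma action_linear: "linear_operator_on domain (action q)"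
  by (auto simp: linear_operator_on_def action_domain action_eqI intertwined_add_right
      intertwined_scaleR_right intertwined_action)

lemma dense_domain: "closure domain = UNIV"
  using finite_rank_space_dense[OF L_algebra] closure_mono[OF finite_rank_space_subset_domain] by blast

lemma group_representation_action: "group_representation quaternion_group domain action"
  using group_quaternion_group finite_quaternion_group subspace_domain dense_domain action_linear
  by (auto simp: group_representation_def quaternion_group_def action_one action_mult)

lemma action_minus_one:
  assumes "x \<in> domain"
  shows "- action (-1) x = x"
  using action_scaleR_left[OF assms, of "-1" 1] by (simp add: action_one)

text \<open>The defining equations pass to limits, because both sides are continuous for each finite rank
  \<open>S\<close>.  The limits are given on the group only; linearity in \<open>q\<close> gives them for all quaternions.\<close>

lemma closed_representation_action: "closed_representation quaternion_group domain action"
  unfolding closed_representation_def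
proof (intro allI impI, elim conjE)
  fix x :: "nat \<Rightarrow> 'a" and w :: "quat \<Rightarrow> 'a"
  assume x: "\<forall>n. x n \<in> domain"
    and w: "\<forall>g\<in>carrier quaternion_group. (\<lambda>n. action g (x n)) \<longlonglongrightarrow> w g"
  have "x \<longlonglongrightarrow> w 1" using w by (simp add: quaternion_group_def action_one)
  have G: "intertwined g (w 1) (w g)" if g: "g \<in> carrier quaternion_group" for g
    unfolding intertwined_def
  proof
    fix S assume S: "S \<in> F"
    have "(\<lambda>n. \<Phi> g (blinfun_apply S (x n))) \<longlonglongrightarrow> \<Phi> g (blinfun_apply S (w 1))"
      by (rule bounded_linear.tendsto[OF bounded_linear_Phi_compose[OF S] \<open>x \<longlonglongrightarrow> w 1\<close>])
    moreover have "(\<lambda>n. blinfun_apply S (action g (x n))) \<longlonglongrightarrow> blinfun_apply S (w g)"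
      using w g by (intro blinfun.tendsto tendsto_const) auto
    ultimately show "blinfun_apply S (w g) = \<Phi> g (blinfun_apply S (w 1))"
      using x S by (simp add: finite_rank_action LIMSEQ_unique)
  qed
  have "w 1 \<in> domain"
  proof (rule domainI)
    fix q
    have "intertwined (qre q *\<^sub>R 1 + qi q *\<^sub>R quat_i + qj q *\<^sub>R quat_j + qk q *\<^sub>R quat_k) (w 1)
        (qre q *\<^sub>R w 1 + qi q *\<^sub>R w quat_i + qj q *\<^sub>R w quat_j + qk q *\<^sub>R w quat_k)"
      by (intro intertwined_add_left intertwined_scaleR_left G) (simp_all add: quaternion_group_def)
    then show "intertwined q (w 1)
        (qre q *\<^sub>R w 1 + qi q *\<^sub>R w quat_i + qj q *\<^sub>R w quat_j + qk q *\<^sub>R w quat_k)"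
      using quat_basis_expansion[of q] by simp
  qed
  moreover have "\<forall>g\<in>carrier quaternion_group. w g = action g (w 1)"
    using action_eqI[OF G] by simp
  ultimately show "\<exists>y\<in>domain. \<forall>g\<in>carrier quaternion_group. w g = action g y" by blast
qed

section \<open>Regularity\<close>

text \<open>On \<open>action g x\<close> the functional \<open>f \<circ> S\<close> takes the value \<open>f (\<Phi> g (S x))\<close>, and \<open>\<Phi> g \<circ> S\<close> is
  bounded.\<close>

lemma compose_finite_rank_in_dual:
  assumes S: "S \<in> F"
  shows "f o\<^sub>L S \<in> representation_dual quaternion_group domain action"
proof -
  have "\<forall>g. \<exists>K. \<forall>x. norm (\<Phi> g (blinfun_apply S x)) \<le> norm x * K"
    using bounded_linear_Phi_compose[OF S] bounded_linear.bounded by blast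
  then obtain K where K: "\<And>g x. norm (\<Phi> g (blinfun_apply S x)) \<le> norm x * K g" by metis
  define C where "C = 1 + norm f * (\<Sum>g\<in>carrier quaternion_group. \<bar>K g\<bar>)"
  have "C > 0" unfolding C_def by (intro add_pos_nonneg mult_nonneg_nonneg sum_nonneg) auto
  moreover have "\<bar>blinfun_apply (f o\<^sub>L S) (action g x)\<bar> \<le> C * norm x"
    if x: "x \<in> domain" and g: "g \<in> carrier quaternion_group" for x g
  proof -
    have "\<bar>blinfun_apply (f o\<^sub>L S) (action g x)\<bar> = norm (blinfun_apply f (\<Phi> g (blinfun_apply S x)))"
      using x S by (simp add: finite_rank_action)
    also have "\<dots> \<le> norm f * norm (\<Phi> g (blinfun_apply S x))" by (rule norm_blinfun)
    also have "\<dots> \<le> norm f * (norm x * K g)" by (intro mult_left_mono K) simp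
    also have "\<dots> \<le> norm f * (norm x * (\<Sum>g\<in>carrier quaternion_group. \<bar>K g\<bar>))"
      using member_le_sum[OF g, of "\<lambda>g. \<bar>K g\<bar>"] finite_quaternion_group
      by (intro mult_left_mono) auto
    also have "\<dots> \<le> C * norm x" by (simp add: C_def algebra_simps)
    finally show ?thesis .
  qed
  ultimately show ?thesis unfolding representation_dual_def by blast
qed

text \<open>The common kernel of all functionals \<open>f \<circ> S\<close> with \<open>S\<close> of finite rank is closed and invariant.
  If it is zero, these functionals are total.  If it is the whole space, then every bounded functional
  vanishes on the dense space \<open>X\<^sub>F\<close>, so the dual is zero and density is trivial.\<close>

lemma regular_representation_action: "regular_representation quaternion_group domain action"
proof -
  let ?M = "representation_dual quaternion_group domain action"
  define N where "N = {x. \<forall>f :: 'a \<Rightarrow>\<^sub>L real. \<forall>S\<in>F. blinfun_apply f (blinfun_apply S x) = 0}"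
  have "N = (\<Inter>f::'a \<Rightarrow>\<^sub>L real. \<Inter>S\<in>F. blinfun_apply (f o\<^sub>L S) -` {0})"
    by (auto simp: N_def)
  then have "closed N"
    by (auto intro!: closed_INT closed_vimage continuous_intros)
  moreover have "subspace N"
    by (auto simp: N_def subspace_def blinfun.add_right blinfun.scaleR_right)
  moreover have "blinfun_apply T x \<in> N" if "T \<in> A" "x \<in> N" for T x
    using that finite_rank_part_ideal(1)[OF L_algebra _ that(1)] by (fastforce simp: N_def)
  ultimately consider "N = {0}" | "N = UNIV"
    using L_algebra transitive_algebraD[of A N] unfolding L_algebra_def by blast
  then show ?thesis
  proof cases
    case 1
    have "x = 0" if "\<And>m. m \<in> ?M \<Longrightarrow> blinfun_apply m x = 0" for x
    proof -
      have "x \<in> N"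
        using that compose_finite_rank_in_dual by (fastforce simp: N_def)
      then show ?thesis using 1 by blast
    qed
    then show ?thesis
      unfolding regular_representation_def
      by (rule total_functionals_weak_star_dense[OF subspace_representation_dual])
  next
    case 2
    have "f = 0" for f :: "'a \<Rightarrow>\<^sub>L real"
    proof (rule blinfun_eqI)
      fix x
      have "blinfun_apply f y = 0" if "y \<in> X\<^sub>F" for y
        using that unfolding finite_rank_space_def
        by (rule linear_eq_0_on_span[OF linear_blinfun_apply, rotated]) (use 2 in \<open>auto simp: N_def\<close>)
      then have "blinfun_apply f ` closure X\<^sub>F \<subseteq> {0}"
        by (intro image_closure_subset linear_continuous_on blinfun.bounded_linear_right) auto
      then show "blinfun_apply f x = blinfun_apply 0 x"
        using finite_rank_space_dense[OF L_algebra] by auto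
    qed
    then have "?M = UNIV"
      using subspace_0[OF subspace_representation_dual, of quaternion_group domain action]
      by (metis UNIV_eq_I)
    then show ?thesis
      unfolding regular_representation_def
      using closure_of_topspace[of weak_star_topology]
      by (simp add: strong_operator_topology_topspace)
  qed
qed

section \<open>The commutant of the representation\<close>

abbreviation "B \<equiv> representation_commutant quaternion_group domain action"

text \<open>For \<open>T\<close> in \<open>A\<close> and \<open>S\<close> of finite rank, the defining equations of \<open>action q x\<close> for \<open>S T\<close> are
  those for \<open>S\<close> at the point \<open>T x\<close>.\<close>

lemma subset_commutant: "A \<subseteq> B"
proof
  fix T assume T: "T \<in> A"
  have *: "intertwined q (blinfun_apply T x) (blinfun_apply T (action q x))" if "x \<in> domain" for q x
    unfolding intertwined_def
  proof
    fix S assume "S \<in> F"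
    then have "S o\<^sub>L T \<in> F" by (rule finite_rank_part_ideal(1)[OF L_algebra _ T])
    from finite_rank_action[OF that this]
    show "blinfun_apply S (blinfun_apply T (action q x)) = \<Phi> q (blinfun_apply S (blinfun_apply T x))"
      by simp
  qed
  have "blinfun_apply T x \<in> domain" if "x \<in> domain" for x
    by (rule domainI[OF *[OF that]])
  then show "T \<in> B"
    using action_eqI[OF *] by (auto simp: representation_commutant_def)
qed

lemma commutant_domain: "T \<in> B \<Longrightarrow> x \<in> domain \<Longrightarrow> blinfun_apply T x \<in> domain"
  by (auto simp: representation_commutant_def)

text \<open>The group spans the quaternions, so commuting with its action implies commuting with the action
  of every quaternion.\<close>

lemma commutant_action:
  assumes "T \<in> B" "x \<in> domain"
  shows "blinfun_apply T (action q x) = action q (blinfun_apply T x)"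
proof -
  have "blinfun_apply T (action g x) = action g (blinfun_apply T x)"
    if "g \<in> {1, quat_i, quat_j, quat_k}" for g
    using assms that by (auto simp: representation_commutant_def quaternion_group_def)
  then have "blinfun_apply T
      (action (qre q *\<^sub>R 1 + qi q *\<^sub>R quat_i + qj q *\<^sub>R quat_j + qk q *\<^sub>R quat_k) x) =
    action (qre q *\<^sub>R 1 + qi q *\<^sub>R quat_i + qj q *\<^sub>R quat_j + qk q *\<^sub>R quat_k) (blinfun_apply T x)"
    using assms by (simp add: action_add_left action_scaleR_left commutant_domain
        blinfun.add_right blinfun.scaleR_right)
  then show ?thesis
    using quat_basis_expansion[of q] by simp
qed

lemma operator_subalgebra_commutant: "operator_subalgebra B"
proof -
  have lin: "\<And>g x y. g \<in> carrier quaternion_group \<Longrightarrow> x \<in> domain \<Longrightarrow> y \<in> domain \<Longrightarrow>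
      action g (x + y) = action g x + action g y"
    "\<And>g r x. x \<in> domain \<Longrightarrow> action g (r *\<^sub>R x) = r *\<^sub>R action g x"
    using action_linear by (auto simp: linear_operator_on_def)
  have "action g 0 = 0" for g
    using lin(2)[of 0 g 0] subspace_0[OF subspace_domain] by simp
  then show ?thesis
    using subspace_domain
    by (auto simp: operator_subalgebra_def subspace_def representation_commutant_def
        blinfun.add_left blinfun.scaleR_left lin image_subset_iff)
qed

lemma transitive_commutant: "transitive_algebra B"
  using L_algebra subset_commutant operator_subalgebra_commutant
  by (auto intro: transitive_algebra_superset simp: L_algebra_def)

lemma L_algebra_commutant: "L_algebra B"
  using L_algebra subset_commutant transitive_commutant unfolding L_algebra_def by blast

text \<open>Testing the commutation with \<open>action\<close> by finite rank operators replaces the unbounded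
  \<open>action q\<close> by the bounded \<open>\<Phi> q \<circ> S\<close>, so membership in the commutant is a system of
  equations between continuous functions of \<open>T\<close>.\<close>

lemma commutant_eq:
  "B = {T. \<forall>q. \<forall>x\<in>domain. \<forall>S\<in>F.
    blinfun_apply S (blinfun_apply T (action q x)) = \<Phi> q (blinfun_apply S (blinfun_apply T x))}"
    (is "_ = ?R")
proof
  show "B \<subseteq> ?R"
    by (auto simp: commutant_action commutant_domain finite_rank_action)
  show "?R \<subseteq> B"
  proof
    fix T assume "T \<in> ?R"
    then have *: "intertwined q (blinfun_apply T x) (blinfun_apply T (action q x))"
      if "x \<in> domain" for q x
      using that by (simp add: intertwined_def)
    have "blinfun_apply T x \<in> domain" if "x \<in> domain" for x
      by (rule domainI[OF *[OF that]])
    then show "T \<in> B"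
      using action_eqI[OF *] by (auto simp: representation_commutant_def)
  qed
qed

lemma closedin_commutant: "closedin strong_operator_topology B"
proof -
  have cl: "closedin strong_operator_topology {T \<in> topspace strong_operator_topology.
      blinfun_apply S (blinfun_apply T y) - \<Phi> q (blinfun_apply S (blinfun_apply T x)) \<in> {0}}"
    if "S \<in> F" for S :: "'a \<Rightarrow>\<^sub>L 'a" and x y :: 'a and q
  proof (rule closedin_continuous_map_preimage)
    have ev: "continuous_map strong_operator_topology euclidean (\<lambda>T::'a \<Rightarrow>\<^sub>L 'a. h (blinfun_apply T z))"
      if "bounded_linear h" for h :: "'a \<Rightarrow> 'a" and z
      using continuous_map_compose[OF strong_operator_topology_continuous_evaluation, of euclidean h z]
        linear_continuous_on[OF that, of UNIV] by (simp add: o_def)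
    have "continuous_map strong_operator_topology euclidean (\<lambda>T. blinfun_apply S (blinfun_apply T y))"
      by (rule ev[OF blinfun.bounded_linear_right])
    moreover have "continuous_map strong_operator_topology euclidean
        (\<lambda>T. \<Phi> q (blinfun_apply S (blinfun_apply T x)))"
      by (rule ev[OF bounded_linear_Phi_compose[OF that]])
    ultimately show "continuous_map strong_operator_topology euclidean (\<lambda>T.
        blinfun_apply S (blinfun_apply T y) - \<Phi> q (blinfun_apply S (blinfun_apply T x)))"
      by (rule continuous_map_diff)
  qed simp
  have "B = topspace strong_operator_topology \<inter> (\<Inter>(q, x, S)\<in>UNIV \<times> domain \<times> F. {T \<in> topspace strong_operator_topology.
      blinfun_apply S (blinfun_apply T (action q x)) - \<Phi> q (blinfun_apply S (blinfun_apply T x)) \<in> {0}})"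
    unfolding commutant_eq by (auto simp: strong_operator_topology_topspace)
  also have "closedin strong_operator_topology \<dots>"
    using cl subspace_0[OF subspace_domain] by (cases "F = {}") (auto intro!: closedin_Int closedin_INT)
  finally show ?thesis .
qed

lemma Lomonosov_commutant: "Lomonosov_algebra B"
  using transitive_commutant closedin_commutant L_algebra_commutant compact_operator_finite_rank
  unfolding Lomonosov_algebra_def L_algebra_def by blast

section \<open>The type of the commutant\<close>


lemma finite_rank_commutant_range:
  assumes "T \<in> finite_rank_part B"
  obtains y where "y \<in> domain" "blinfun_apply T x = blinfun_apply T y"
proof -
  have "blinfun_apply T ` domain = range (blinfun_apply T)"
    using assms by (intro finite_rank_image_dense subspace_domain dense_domain)
      (simp add: finite_rank_part_def)
  then have "blinfun_apply T x \<in> blinfun_apply T ` domain" by blast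
  then show ?thesis using that by auto
qed

lemma finite_rank_part_subset: "F \<subseteq> finite_rank_part B"
  using subset_commutant by (auto simp: finite_rank_part_def)

lemma finite_rank_space_mono: "X\<^sub>F \<subseteq> finite_rank_space B"
  unfolding finite_rank_space_def using finite_rank_part_subset by (intro span_mono) blast

text \<open>A finite rank \<open>T\<close> maps the dense subspace \<open>domain\<close> already onto its range, so the range lies in
  \<open>domain\<close>, and \<open>action q\<close> maps it to itself.\<close>

lemma finite_rank_space_commutant:
  assumes "x \<in> finite_rank_space B"
  shows "x \<in> domain \<and> action q x \<in> finite_rank_space B"
proof -
  let ?V = "{x \<in> domain. action q x \<in> finite_rank_space B}"
  have lin: "action q (x + y) = action q x + action q y" "action q (r *\<^sub>R x) = r *\<^sub>R action q x"
    if "x \<in> domain" "y \<in> domain" for x y r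
    using action_linear that by (auto simp: linear_operator_on_def)
  have "action q 0 = 0"
    using lin(2)[of 0 0 0] subspace_0[OF subspace_domain] by simp
  then have "subspace ?V"
    using subspace_domain subspace_finite_rank_space[of B] by (auto simp: subspace_def lin)
  moreover have "{blinfun_apply T x |T x. T \<in> finite_rank_part B} \<subseteq> ?V"
  proof clarify
    fix T x assume T: "T \<in> finite_rank_part B"
    then obtain y where y: "y \<in> domain" "blinfun_apply T x = blinfun_apply T y"
      using finite_rank_commutant_range by blast
    have "T \<in> B" using T by (simp add: finite_rank_part_def)
    with y have "blinfun_apply T x \<in> domain" 
      "action q (blinfun_apply T x) = blinfun_apply T (action q y)"
      by (simp_all add: commutant_domain commutant_action)
    then show "blinfun_apply T x \<in> domain \<and> action q (blinfun_apply T x) \<in> finite_rank_space B"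
      using finite_rank_part_apply[OF T] by simp
  qed
  ultimately have "finite_rank_space B \<subseteq> ?V"
    unfolding finite_rank_space_def[of B] by (metis (no_types, lifting) span_minimal)
  then show ?thesis using assms by blast
qed

lemma restrict_action_commutant:
  "restrict (action q) (finite_rank_space B) \<in> finite_rank_commutant B"
  using finite_rank_space_commutant action_linear subspace_finite_rank_space[of B]
  by (auto simp: finite_rank_commutant_def linear_operator_on_def subspace_add subspace_scale
      finite_rank_part_apply commutant_action finite_rank_part_def)

text \<open>Every \<open>T\<close> in \<open>F\<close> attains its whole range on the dense space \<open>X\<^sub>F\<close>, so \<open>R\<close> maps \<open>X\<^sub>F\<close> into itself and
  its restriction there is some \<open>\<Phi> q\<close>.  Then \<open>S (R y) = R (S y) = \<Phi> q (S y)\<close> for \<open>S\<close> in \<open>F\<close>, and uniqueness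
  of intertwined values gives \<open>R y = action q y\<close>.\<close>

lemma finite_rank_commutant_eq_action:
  assumes R: "R \<in> finite_rank_commutant B"
  obtains q where "R = restrict (action q) (finite_rank_space B)"
proof -
  let ?Y = "finite_rank_space B"
  have lin: "linear_operator_on ?Y R"
    and comm: "\<And>T y. T \<in> finite_rank_part B \<Longrightarrow> y \<in> ?Y \<Longrightarrow> R (blinfun_apply T y) = blinfun_apply T (R y)"
    and ext: "R \<in> extensional ?Y"
    using R by (auto simp: finite_rank_commutant_def)
  have R_add: "\<And>x y. x \<in> ?Y \<Longrightarrow> y \<in> ?Y \<Longrightarrow> R (x + y) = R x + R y"
    and R_scale: "\<And>r x. x \<in> ?Y \<Longrightarrow> R (r *\<^sub>R x) = r *\<^sub>R R x"
    using lin by (simp_all add: linear_operator_on_def)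
  have RX: "R x \<in> X\<^sub>F" if "x \<in> X\<^sub>F" for x
  proof -
    let ?V = "{x \<in> X\<^sub>F. R x \<in> X\<^sub>F}"
    have "R 0 = 0" using R_scale[of 0 0] subspace_0[OF subspace_finite_rank_space[of B]] by simp
    then have "subspace ?V"
      using subspace_finite_rank_space[of A] finite_rank_space_mono R_add R_scale
      by (simp add: subspace_def subset_iff)
    moreover have "{blinfun_apply T x |T x. T \<in> F} \<subseteq> ?V"
    proof clarify
      fix T x assume T: "T \<in> F"
      have "blinfun_apply T ` X\<^sub>F = range (blinfun_apply T)"
        using T finite_rank_space_dense[OF L_algebra] subspace_finite_rank_space
        by (intro finite_rank_image_dense) (auto simp: finite_rank_part_def)
      then have "blinfun_apply T x \<in> blinfun_apply T ` X\<^sub>F" by blast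
      then obtain y where y: "y \<in> X\<^sub>F" "blinfun_apply T x = blinfun_apply T y" by auto
      have "R (blinfun_apply T y) = blinfun_apply T (R y)"
        using T y(1) finite_rank_part_subset finite_rank_space_mono by (intro comm) auto
      then show "blinfun_apply T x \<in> X\<^sub>F \<and> R (blinfun_apply T x) \<in> X\<^sub>F"
        using y T by (simp add: finite_rank_part_apply)
    qed
    ultimately have "X\<^sub>F \<subseteq> ?V"
      unfolding finite_rank_space_def[of A] by (metis (no_types, lifting) span_minimal)
    then show ?thesis using that by blast
  qed
  have "restrict R X\<^sub>F \<in> finite_rank_commutant A"
    using RX finite_rank_space_mono finite_rank_part_subset R_add R_scale comm
      subspace_finite_rank_space[of A]
    by (auto simp: finite_rank_commutant_def linear_operator_on_def subspace_add subspace_scale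
        finite_rank_part_apply subset_iff)
  then obtain q where q: "\<Phi> q = restrict R X\<^sub>F"
    using iso by (metis operator_algebra_iso_def bij_betw_imp_surj_on imageE)
  have "action q y = R y" if y: "y \<in> ?Y" for y
  proof (rule action_eqI, unfold intertwined_def, intro ballI)
    fix S assume S: "S \<in> F"
    then have "blinfun_apply S (R y) = R (blinfun_apply S y)"
      using comm y finite_rank_part_subset by auto
    then show "blinfun_apply S (R y) = \<Phi> q (blinfun_apply S y)"
      using q S by (simp add: finite_rank_part_apply)
  qed
  then have "R = restrict (action q) ?Y"
    using ext by (intro extensionalityI[of R ?Y]) auto
  then show ?thesis by (rule that)
qed

text \<open>Each \<open>action q\<close> extends \<open>\<Phi> q\<close>, which gives injectivity.\<close>

lemma quaternion_type_commutant: "quaternion_type B"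
proof -
  let ?Y = "finite_rank_space B"
  let ?\<Psi> = "\<lambda>q. restrict (action q) ?Y"
  have "inj ?\<Psi>"
  proof (rule injI)
    fix p q assume eq: "?\<Psi> p = ?\<Psi> q"
    have "\<Phi> p = \<Phi> q"
    proof (rule extensionalityI)
      show "\<Phi> p \<in> extensional X\<^sub>F" "\<Phi> q \<in> extensional X\<^sub>F"
        using Phi_commutant by (auto simp: finite_rank_commutant_def)
      fix x assume x: "x \<in> X\<^sub>F"
      have "\<Phi> r x = ?\<Psi> r x" for r
        using action_eqI[OF intertwined_Phi[OF x]] x finite_rank_space_mono by auto
      then show "\<Phi> p x = \<Phi> q x" using eq by metis
    qed
    then show "p = q"
      using iso unfolding operator_algebra_iso_def bij_betw_def by (auto dest: injD)
  qed
  moreover have "range ?\<Psi> = finite_rank_commutant B"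
    using restrict_action_commutant finite_rank_commutant_eq_action by blast
  ultimately have "operator_algebra_iso ?Y (finite_rank_commutant B) ?\<Psi>"
    using finite_rank_space_commutant
    by (simp add: operator_algebra_iso_def bij_betw_def action_add_left action_scaleR_left action_mult)
  then show ?thesis
    unfolding quaternion_type_def using L_algebra_commutant by blast
qed

end

theorem theorem4p8:
  fixes A :: "('a::banach \<Rightarrow>\<^sub>L 'a) set"
  assumes infinite_dimensional: "\<not> (\<exists>B :: 'a set. finite B \<and> span B = UNIV)"
    and L_algebra: "L_algebra A"
    and quaternion_type: "quaternion_type A"
  shows "\<exists>(E :: 'a set) (\<pi> :: quat \<Rightarrow> 'a \<Rightarrow> 'a).
    group_representation quaternion_group E \<pi> \<and>
    closed_representation quaternion_group E \<pi> \<and>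
    regular_representation quaternion_group E \<pi> \<and>
    (\<forall>x\<in>E. \<pi> 1 x = x \<and> - \<pi> (-1) x = x) \<and>
    A \<subseteq> representation_commutant quaternion_group E \<pi> \<and>
    Lomonosov_algebra (representation_commutant quaternion_group E \<pi>) \<and>
    quaternion_type (representation_commutant quaternion_group E \<pi>)"
proof -
  obtain \<Phi> :: "quat \<Rightarrow> 'a \<Rightarrow> 'a"
    where iso: "operator_algebra_iso (finite_rank_space A) (finite_rank_commutant A) \<Phi>"
    using quaternion_type unfolding quaternion_type_def by blast
  interpret quaternionic_L_algebra A \<Phi>
    by unfold_locales (fact L_algebra, fact iso)
  show ?thesis
    using group_representation_action closed_representation_action regular_representation_action
      action_one action_minus_one subset_commutant Lomonosov_commutant quaternion_type_commutant
    by (intro exI[of _ domain] exI[of _ action]) simp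
qed

end
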